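(* Let $n$ be a positive integer or $n=\infty$, and let $T=(T_1,\ldots,T_n)$ be an $n$-tuple of non-zero bounded operators on a Hilbert space $\mathcal H$ with $\sum_{i=1}^nT_iT_i^*\le I_{\mathcal H}$. Let $\mathcal P=\{P_k\}_{k\in V(G)}$ be a countable family of projections which stabilizes $T$, such that for every $k$ there is some $i$ with $T_iP_k\neq0$, where $G$ is the associated directed graph, and write $T=(T_e)_{e\in E(G)}$. Let $S=(S_e)_{e\in E(G)}$ on $\mathcal K\supseteq\mathcal H$ be a minimal partially isometric dilation of $T=(T_e)_{e\in E(G)}$ with respect to the projections $\mathcal P$. Then for every $k\in V(G)$, $$\operatorname{rank}\Bigl(Q_k\bigl(I_{\mathcal K}-\sum_eS_eS_e^*\bigr)\Bigr)=\operatorname{rank}\Bigl(P_k\bigl(I_{\mathcal H}-\sum_eT_eT_e^*\bigr)\Bigr),$$ where $\{Q_k\}_{k\in V(G)}$ are the distinct projections among $\{S_e^*S_e:e\in E(G)\}$, labelled so that $Q_k|_{\mathcal H}=P_k$.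
   Context: Projections are orthogonal projections; infinite sums of operators are in the strong operator topology; $\vee$ denotes closed linear span; rank means the Hilbert space dimension of the closure of the range. Stabilizing family: a countable family $\mathcal P=\{P_k:k\in\mathcal J\}$ of projections on $\mathcal H$ stabilizes $T$ if $P_kT_i\in\{T_i,0\}$ and $T_iP_k\in\{T_i,0\}$ for all $k$ and $i$, and $\sum_{k\in\mathcal J}P_k=I_{\mathcal H}$. For each $i$ let $s(T_i),r(T_i)\in\mathcal J$ be the indices with $T_iP_{s(T_i)}=T_i$ and $P_{r(T_i)}T_i=T_i$. The associated directed graph $G$ has vertex set $V(G)=\mathcal J$ and one edge for each $i$, from $s(T_i)$ to $r(T_i)$; re-indexing by edges gives $T=(T_e)_{e\in E(G)}$. Relations $(\dagger)$: an $n$-tuple $S=(S_1,\ldots,S_n)$ of non-zero operators on a Hilbert space $\mathcal K$ satisfies $(\dagger)$ if (1) $(S_i^*S_i)^2=S_i^*S_i$ for all $i$; (2) $\sum_iS_iS_i^*\le I$; (3) for all $i,j$, either $(S_i^*S_i)(S_j^*S_j)=0$ or $S_i^*S_i=S_j^*S_j$; (4) for every $i$ there is $j$ with $S_iS_i^*\le S_j^*S_j$; (5) if $\{Q_k\}$ are the distinct elements of $\{S_i^*S_i\}$, then $\sum_kQ_k=I$. Minimal partially isometric dilation of $T$: an $n$-tuple $S$ on $\mathcal K\supseteq\mathcal H$ such that (i) $S$ satisfies $(\dagger)$; (ii) $\mathcal H$ reduces each $S_i^*S_i$, and is invariant for each $S_i^*$ with $S_i^*|_{\mathcal H}=T_i^*$;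 (iii) $\mathcal K=\mathcal H\vee\bigl(\bigvee_{i_1,\ldots,i_k;\,k\ge1}S_{i_1}\cdots S_{i_k}\mathcal H\bigr)$. It is a dilation with respect to $\mathcal P$ if in addition $\mathcal P=\{S_i^*S_i|_{\mathcal H}:1\le i\le n\}$. *)

theory Defs
  imports
    "HOL-Analysis.Analysis"
    "HOL-Library.Extended_Nat"
    "Graph_Theory.Digraph"
begin

unbundle cardinal_syntax

section \<open>Complex Hilbert spaces\<close>

text \<open>The real structure carried by \<open>real_inner\<close> is the underlying one:
  \<open>scaleR\<close> is the restriction of \<open>scaleC\<close> and \<open>inner\<close> the real part of \<open>cinner\<close>.
  Hence positive definiteness of \<open>cinner\<close>, the norm and the topology are inherited.
  The inner product is linear in its first argument.\<close>

class complex_inner = real_inner +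
  fixes scaleC :: "complex \<Rightarrow> 'a \<Rightarrow> 'a"  (infixr "*\<^sub>C" 75)
    and cinner :: "'a \<Rightarrow> 'a \<Rightarrow> complex"
  assumes scaleC_add_right: "c *\<^sub>C (x + y) = c *\<^sub>C x + c *\<^sub>C y"
    and scaleC_add_left: "(c + d) *\<^sub>C x = c *\<^sub>C x + d *\<^sub>C x"
    and scaleC_scaleC: "c *\<^sub>C d *\<^sub>C x = (c * d) *\<^sub>C x"
    and scaleC_one: "1 *\<^sub>C x = x"
    and scaleR_scaleC: "scaleR r x = complex_of_real r *\<^sub>C x"
    and cinner_commute: "cinner x y = cnj (cinner y x)"
    and cinner_add_left: "cinner (x + y) z = cinner x z + cinner y z"
    and cinner_scaleC_left: "cinner (c *\<^sub>C x) y = c * cinner x y"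
    and inner_cinner: "inner x y = Re (cinner x y)"

class complex_hilbert = complex_inner + complete_space

instantiation complex :: complex_hilbert
begin
definition scaleC_complex :: "complex \<Rightarrow> complex \<Rightarrow> complex"
  where "scaleC_complex c x = c * x"
definition cinner_complex :: "complex \<Rightarrow> complex \<Rightarrow> complex"
  where "cinner_complex x y = x * cnj y"
instance
  by standard
    (simp_all add: scaleC_complex_def cinner_complex_def inner_complex_def
      algebra_simps scaleR_conv_of_real)
end

global_interpretation complex_vector:
  vector_space "scaleC :: complex \<Rightarrow> 'a \<Rightarrow> 'a::complex_inner"
  by standard (simp_all add: scaleC_add_right scaleC_add_left scaleC_scaleC scaleC_one)

definition closed_cspan :: "'a::complex_inner set \<Rightarrow> 'a set"
  where "closed_cspan X = closure (complex_vector.span X)"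

definition ortho_compl :: "'a::complex_inner set \<Rightarrow> 'a set"
  where "ortho_compl M = {y. \<forall>x\<in>M. cinner x y = 0}"

text \<open>The cardinality of any orthonormal basis of the closed subspace \<open>M\<close>, as a cardinal
  in the sense of the library; cardinals over different types are compared with \<open>=o\<close>.\<close>

definition orthonormal_basis :: "'a::complex_inner set \<Rightarrow> 'a set \<Rightarrow> bool"
  where "orthonormal_basis M B \<longleftrightarrow>
    (\<forall>x\<in>B. \<forall>y\<in>B. cinner x y = (if x = y then 1 else 0)) \<and> closed_cspan B = M"

definition hilbert_dim :: "'a::complex_inner set \<Rightarrow> 'a rel"
  where "hilbert_dim M = |SOME B. orthonormal_basis M B|"


section \<open>Operators\<close>

definition bounded_op :: "('a::complex_inner \<Rightarrow> 'b::complex_inner) \<Rightarrow> bool"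
  where "bounded_op A \<longleftrightarrow> bounded_linear A \<and> (\<forall>c x. A (c *\<^sub>C x) = c *\<^sub>C A x)"

definition adj :: "('a::complex_inner \<Rightarrow> 'b::complex_inner) \<Rightarrow> 'b \<Rightarrow> 'a"
  where "adj A = (THE B. \<forall>x y. cinner (A x) y = cinner x (B y))"

definition projection :: "('a::complex_inner \<Rightarrow> 'a) \<Rightarrow> bool"
  where "projection P \<longleftrightarrow> bounded_op P \<and> P \<circ> P = P \<and> adj P = P"

definition op_le :: "('a::complex_inner \<Rightarrow> 'a) \<Rightarrow> ('a \<Rightarrow> 'a) \<Rightarrow> bool"
  where "op_le A B \<longleftrightarrow> (\<forall>x. cinner (B x - A x) x \<in> \<real>\<^sub>\<ge>\<^sub>0)"

definition op_rank :: "('a::complex_inner \<Rightarrow> 'b::complex_inner) \<Rightarrow> 'b rel"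
  where "op_rank A = hilbert_dim (closure (range A))"

definition reduces :: "'a::complex_inner set \<Rightarrow> ('a \<Rightarrow> 'a) \<Rightarrow> bool"
  where "reduces M A \<longleftrightarrow> A ` M \<subseteq> M \<and> A ` ortho_compl M \<subseteq> ortho_compl M"

text \<open>Sums of operators in the strong operator topology, over a possibly infinite index set.
  The value of \<open>sot_sum\<close> is meaningful only under \<open>sot_summable\<close>.\<close>

definition sot_summable :: "('i \<Rightarrow> 'a \<Rightarrow> 'b::complex_inner) \<Rightarrow> 'i set \<Rightarrow> bool"
  where "sot_summable A I \<longleftrightarrow> (\<forall>x. (\<lambda>i. A i x) summable_on I)"

definition sot_sum :: "('i \<Rightarrow> 'a \<Rightarrow> 'b::complex_inner) \<Rightarrow> 'i set \<Rightarrow> 'a \<Rightarrow> 'b"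
  where "sot_sum A I = (\<lambda>x. \<Sum>\<^sub>\<infinity>i\<in>I. A i x)"

definition row_contraction :: "'i set \<Rightarrow> ('i \<Rightarrow> 'a::complex_inner \<Rightarrow> 'a) \<Rightarrow> bool"
  where "row_contraction I T \<longleftrightarrow>
    sot_summable (\<lambda>i. T i \<circ> adj (T i)) I \<and> op_le (sot_sum (\<lambda>i. T i \<circ> adj (T i)) I) id"

definition defect :: "'i set \<Rightarrow> ('i \<Rightarrow> 'a::complex_inner \<Rightarrow> 'a) \<Rightarrow> 'a \<Rightarrow> 'a"
  where "defect I T = (\<lambda>x. x - sot_sum (\<lambda>i. T i \<circ> adj (T i)) I x)"

definition nonzero_ops :: "'i set \<Rightarrow> ('i \<Rightarrow> 'a::complex_inner \<Rightarrow> 'a) \<Rightarrow> bool"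
  where "nonzero_ops I T \<longleftrightarrow> (\<forall>i\<in>I. bounded_op (T i) \<and> T i \<noteq> (\<lambda>_. 0))"


section \<open>Stabilizing families and their directed graphs\<close>

definition stabilizes ::
  "'v set \<Rightarrow> ('v \<Rightarrow> 'a::complex_inner \<Rightarrow> 'a) \<Rightarrow> 'i set \<Rightarrow> ('i \<Rightarrow> 'a \<Rightarrow> 'a) \<Rightarrow> bool"
  where "stabilizes J P I T \<longleftrightarrow>
    countable J \<and> (\<forall>k\<in>J. projection (P k)) \<and>
    (\<forall>k\<in>J. \<forall>i\<in>I. P k \<circ> T i \<in> {T i, \<lambda>_. 0} \<and> T i \<circ> P k \<in> {T i, \<lambda>_. 0}) \<and>
    sot_summable P J \<and> sot_sum P J = id"

text \<open>The sum of the \<open>P k\<close> being the identity, they are mutually orthogonal, so for a nonzero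
  \<open>T i\<close> the descriptions below are proper.\<close>

definition assoc_graph ::
  "'v set \<Rightarrow> ('v \<Rightarrow> 'a::complex_inner \<Rightarrow> 'a) \<Rightarrow> 'i set \<Rightarrow> ('i \<Rightarrow> 'a \<Rightarrow> 'a) \<Rightarrow> ('v, 'i) pre_digraph"
  where "assoc_graph J P I T =
    \<lparr> verts = J, arcs = I,
      tail = (\<lambda>i. THE k. k \<in> J \<and> T i \<circ> P k = T i),
      head = (\<lambda>i. THE k. k \<in> J \<and> P k \<circ> T i = T i) \<rparr>"


section \<open>Minimal partially isometric dilations\<close>

definition initial_projections :: "'i set \<Rightarrow> ('i \<Rightarrow> 'a::complex_inner \<Rightarrow> 'a) \<Rightarrow> ('a \<Rightarrow> 'a) set"
  where "initial_projections I S = (\<lambda>i. adj (S i) \<circ> S i) ` I"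

definition dagger_relations :: "'i set \<Rightarrow> ('i \<Rightarrow> 'a::complex_inner \<Rightarrow> 'a) \<Rightarrow> bool"
  where "dagger_relations I S \<longleftrightarrow>
    nonzero_ops I S \<and>
    (\<forall>i\<in>I. (adj (S i) \<circ> S i) \<circ> (adj (S i) \<circ> S i) = adj (S i) \<circ> S i) \<and>
    row_contraction I S \<and>
    (\<forall>i\<in>I. \<forall>j\<in>I. (adj (S i) \<circ> S i) \<circ> (adj (S j) \<circ> S j) = (\<lambda>_. 0) \<or>
                  adj (S i) \<circ> S i = adj (S j) \<circ> S j) \<and>
    (\<forall>i\<in>I. \<exists>j\<in>I. op_le (S i \<circ> adj (S i)) (adj (S j) \<circ> S j)) \<and>
    sot_summable (\<lambda>Q. Q) (initial_projections I S) \<and>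
    sot_sum (\<lambda>Q. Q) (initial_projections I S) = id"

text \<open>The inclusion of \<open>\<H>\<close> in the larger space \<open>\<K>\<close> is rendered by an isometric embedding
  \<open>\<iota>\<close>, so that \<open>\<H>\<close> as a subspace of \<open>\<K>\<close> is \<open>range \<iota>\<close>. The operator \<open>restr \<iota> A\<close> is the
  restriction to \<open>\<H>\<close> of an operator \<open>A\<close> on \<open>\<K>\<close> that leaves \<open>range \<iota>\<close> invariant.\<close>

definition isometric_embedding :: "('h::complex_inner \<Rightarrow> 'k::complex_inner) \<Rightarrow> bool"
  where "isometric_embedding \<iota> \<longleftrightarrow> bounded_op \<iota> \<and> (\<forall>x y. cinner (\<iota> x) (\<iota> y) = cinner x y)"

definition restr :: "('h \<Rightarrow> 'k) \<Rightarrow> ('k \<Rightarrow> 'k) \<Rightarrow> 'h \<Rightarrow> 'h"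
  where "restr \<iota> A = inv \<iota> \<circ> A \<circ> \<iota>"

definition word_op :: "('i \<Rightarrow> 'a \<Rightarrow> 'a) \<Rightarrow> 'i list \<Rightarrow> 'a \<Rightarrow> 'a"
  where "word_op S w = foldr (\<lambda>i A. S i \<circ> A) w id"

definition min_pi_dilation ::
  "('h::complex_inner \<Rightarrow> 'k::complex_inner) \<Rightarrow> 'i set \<Rightarrow> ('i \<Rightarrow> 'h \<Rightarrow> 'h) \<Rightarrow> ('i \<Rightarrow> 'k \<Rightarrow> 'k) \<Rightarrow> bool"
  where "min_pi_dilation \<iota> I T S \<longleftrightarrow>
    isometric_embedding \<iota> \<and>
    dagger_relations I S \<and>
    (\<forall>i\<in>I. reduces (range \<iota>) (adj (S i) \<circ> S i) \<and>
           adj (S i) ` range \<iota> \<subseteq> range \<iota> \<and> restr \<iota> (adj (S i)) = adj (T i)) \<and>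
    closed_cspan (range \<iota> \<union> (\<Union>w\<in>{w. w \<noteq> [] \<and> set w \<subseteq> I}. word_op S w ` range \<iota>)) = UNIV"

definition min_pi_dilation_wrt ::
  "('h::complex_inner \<Rightarrow> 'k::complex_inner) \<Rightarrow> 'i set \<Rightarrow> ('i \<Rightarrow> 'h \<Rightarrow> 'h) \<Rightarrow> ('i \<Rightarrow> 'k \<Rightarrow> 'k) \<Rightarrow>
    ('h \<Rightarrow> 'h) set \<Rightarrow> bool"
  where "min_pi_dilation_wrt \<iota> I T S \<P> \<longleftrightarrow>
    min_pi_dilation \<iota> I T S \<and> \<P> = restr \<iota> ` initial_projections I S"

end

theory Submission
  imports Defs "HOL-Library.Countable_Set_Type"
begin

text \<open>
  Write \<open>D\<^sub>S\<close> and \<open>D\<^sub>T\<close> for the two defect operators and \<open>E = Q k \<circ> D\<^sub>S\<close>. The \<open>S i\<close> are partial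
  isometries whose ranges are pairwise orthogonal and each lie inside, or orthogonal to, the range
  of \<open>Q k\<close>. Hence \<open>D\<^sub>S\<close> is a projection that annihilates all ranges of the \<open>S i\<close> and commutes with
  \<open>Q k\<close>, so \<open>E\<close> is a projection that kills every vector \<open>S\<^sub>w h\<close> with a nonempty word \<open>w\<close>. By
  minimality the vectors left over, those of \<open>range \<iota>\<close>, already have dense image: the range of \<open>E\<close>
  and the range of \<open>A = E \<circ> \<iota>\<close> have the same closure (\<open>closure_range_initial_defect\<close>).

  The Gram operator of \<open>A\<close> lives on the small space. Since the adjoints of the \<open>S i\<close> restrict to
  the adjoints of the \<open>T i\<close>, the forms of \<open>D\<^sub>S\<close> and \<open>D\<^sub>T\<close> agree on it (\<open>cinner_defect_dilation\<close>),
  and \<open>Q k\<close> restricts to \<open>P k\<close>; therefore \<open>adj A \<circ> A = adj \<iota> \<circ> E \<circ> \<iota> = P k \<circ> D\<^sub>T\<close>. It remains that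
  a bounded operator has the same rank as its Gram operator (\<open>op_rank_adj_comp\<close>). This comes from
  comparing orthonormal bases through injective bounded operators in both directions
  (\<open>card_orthonormal_le_of_injective\<close>). That the rank and the adjoint are meaningful at all rests on
  the orthogonal decomposition along a closed subspace.
\<close>

section \<open>Geometry of complex inner product spaces\<close>

lemma cinner_add_right: "cinner x (y + z) = cinner x y + cinner x z"
  by (metis cinner_add_left cinner_commute complex_cnj_add)

lemma cinner_scaleC_right: "cinner x (c *\<^sub>C y) = cnj c * cinner x y"
  by (metis cinner_commute cinner_scaleC_left complex_cnj_mult)

lemma cinner_scaleR_left: "cinner (r *\<^sub>R x) y = complex_of_real r * cinner x y"
  by (simp add: scaleR_scaleC cinner_scaleC_left)

lemma cinner_scaleR_right: "cinner x (r *\<^sub>R y) = complex_of_real r * cinner x y"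
  by (simp add: scaleR_scaleC cinner_scaleC_right)

lemma cinner_zero_left [simp]: "cinner 0 y = 0"
  using cinner_add_left[of 0 0 y] by simp

lemma cinner_zero_right [simp]: "cinner x 0 = 0"
  using cinner_add_right[of x 0 0] by simp

lemma cinner_diff_left: "cinner (x - y) z = cinner x z - cinner y z"
  using cinner_add_left[of "x - y" y z] by simp

lemma cinner_diff_right: "cinner x (y - z) = cinner x y - cinner x z"
  using cinner_add_right[of x "y - z" z] by simp

lemma cinner_self: "cinner x x = complex_of_real ((norm x)\<^sup>2)"
proof (rule complex_eqI)
  show "Re (cinner x x) = Re (complex_of_real ((norm x)\<^sup>2))"
    by (simp add: inner_cinner[symmetric] power2_norm_eq_inner)
  have "Im (cinner x x) = - Im (cinner x x)"
    using cinner_commute[of x x] by (metis cnj.sel(2))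
  then show "Im (cinner x x) = Im (complex_of_real ((norm x)\<^sup>2))"
    by simp
qed

lemma norm_power2_cinner: "(norm x)\<^sup>2 = cmod (cinner x x)"
  by (simp add: cinner_self norm_power)

lemma cinner_self_eq_zero [simp]: "cinner x x = 0 \<longleftrightarrow> x = 0"
  by (simp add: cinner_self)

lemma cinner_eqI_left:
  assumes "\<And>z. cinner x z = cinner y z"
  shows "x = y"
proof -
  have "cinner (x - y) (x - y) = 0"
    using assms by (simp add: cinner_diff_left)
  then show ?thesis by simp
qed

lemma cinner_eqI_right:
  assumes "\<And>z. cinner z x = cinner z y"
  shows "x = y"
  by (rule cinner_eqI_left) (metis assms cinner_commute)

lemma norm_scaleC: "norm (c *\<^sub>C x) = cmod c * norm x"
proof -
  have "complex_of_real ((norm (c *\<^sub>C x))\<^sup>2) = (c * cnj c) * complex_of_real ((norm x)\<^sup>2)"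
    by (simp only: cinner_self[symmetric] cinner_scaleC_left cinner_scaleC_right ac_simps)
  also have "\<dots> = complex_of_real ((cmod c * norm x)\<^sup>2)"
    by (simp add: complex_norm_square[symmetric] power_mult_distrib)
  finally have "(norm (c *\<^sub>C x))\<^sup>2 = (cmod c * norm x)\<^sup>2"
    using of_real_eq_iff by blast
  then show ?thesis by simp
qed

lemma norm_cinner_le: "cmod (cinner x y) \<le> norm x * norm y"
proof (cases "cinner x y = 0")
  case False
  \<comment> \<open>Rotating \<open>x\<close> makes the complex inner product real, hence equal to the real one.\<close>
  define c where "c = cnj (cinner x y) / cmod (cinner x y)"
  have c: "cmod c = 1"
    using False by (simp add: c_def norm_divide)
  have "cinner (c *\<^sub>C x) y = complex_of_real (cmod (cinner x y))"
    using False complex_norm_square[of "cinner x y"]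
    by (simp add: c_def cinner_scaleC_left field_simps power2_eq_square)
  then have "cmod (cinner x y) = inner (c *\<^sub>C x) y"
    by (simp add: inner_cinner)
  also have "\<dots> \<le> norm (c *\<^sub>C x) * norm y"
    by (rule norm_cauchy_schwarz)
  finally show ?thesis
    by (simp add: norm_scaleC c)
qed simp

lemma bounded_linear_cinner_left: "bounded_linear (\<lambda>x. cinner x y)"
  by (rule bounded_linear_intro[where K = "norm y"])
    (simp_all add: cinner_add_left cinner_scaleR_left scaleR_conv_of_real norm_cinner_le)

lemma bounded_linear_scaleC: "bounded_linear (\<lambda>x. c *\<^sub>C x)"
  by (rule bounded_linear_intro[where K = "cmod c"])
    (simp_all add: scaleC_add_right scaleR_scaleC scaleC_scaleC norm_scaleC mult.commute)

lemma csubspace_imp_subspace: "complex_vector.subspace M \<Longrightarrow> subspace M"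
  by (simp add: complex_vector.subspace_def subspace_def scaleR_scaleC)

lemma csubspace_closure:
  assumes "complex_vector.subspace M"
  shows "complex_vector.subspace (closure M)"
proof -
  have "c *\<^sub>C x \<in> closure M" if "x \<in> closure M" for c x
  proof -
    have "(\<lambda>x. c *\<^sub>C x) ` closure M \<subseteq> closure ((\<lambda>x. c *\<^sub>C x) ` M)"
      by (rule closure_bounded_linear_image_subset[OF bounded_linear_scaleC])
    also have "\<dots> \<subseteq> closure M"
      using assms by (intro closure_mono) (auto simp: complex_vector.subspace_def)
    finally show ?thesis using that by blast
  qed
  moreover have "x + y \<in> closure M" if xy: "x \<in> closure M" "y \<in> closure M" for x y
  proof -
    obtain f g where "\<And>n. f n \<in> M" "\<And>n. g n \<in> M" "f \<longlonglongrightarrow> x" "g \<longlonglongrightarrow> y"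
      using xy unfolding closure_sequential by metis
    then show ?thesis
      unfolding closure_sequential using assms
      by (intro exI[of _ "\<lambda>n. f n + g n"]) (simp add: tendsto_add complex_vector.subspace_add)
  qed
  moreover have "0 \<in> closure M"
    using assms closure_subset by (auto simp: complex_vector.subspace_def)
  ultimately show ?thesis
    by (simp add: complex_vector.subspace_def)
qed

lemma csubspace_closed_cspan: "complex_vector.subspace (closed_cspan X)"
  unfolding closed_cspan_def by (intro csubspace_closure complex_vector.subspace_span)

lemma closed_cspan_minimal:
  assumes "X \<subseteq> M" "complex_vector.subspace M" "closed M"
  shows "closed_cspan X \<subseteq> M"
  unfolding closed_cspan_def
  using assms by (intro closure_minimal complex_vector.span_minimal)

lemma closed_cspan_superset: "X \<subseteq> closed_cspan X"
  unfolding closed_cspan_def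
  using closure_subset complex_vector.span_superset by blast

lemma csubspace_cinner_zero_left: "complex_vector.subspace {x. cinner x z = 0}"
  by (simp add: complex_vector.subspace_def cinner_add_left cinner_scaleC_left)

lemma closed_cinner_zero_left: "closed {x. cinner x z = 0}"
  by (intro closed_Collect_eq bounded_linear.continuous_on[OF bounded_linear_cinner_left]
      continuous_intros)

lemma cinner_closed_cspan_zero:
  assumes "\<And>b. b \<in> B \<Longrightarrow> cinner b z = 0" "x \<in> closed_cspan B"
  shows "cinner x z = 0"
  using closed_cspan_minimal[OF _ csubspace_cinner_zero_left closed_cinner_zero_left, of B z] assms
  by blast

lemma cinner_closure_zero:
  assumes "\<And>x. x \<in> X \<Longrightarrow> cinner x z = 0" "x \<in> closure X"
  shows "cinner x z = 0"
  using closure_minimal[OF _ closed_cinner_zero_left, of X z] assms by blast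


section \<open>Orthogonal decomposition and orthonormal bases\<close>

text \<open>By the parallelogram law the sets of almost nearest points shrink to diameter zero, so by
  completeness there is a nearest point \<open>p\<close>; comparing it with \<open>p + t y\<close> shows orthogonality.\<close>

lemma exists_orthogonal_foot:
  fixes M :: "'a::{real_inner, complete_space} set"
  assumes "closed M" "subspace M"
  obtains p where "p \<in> M" "\<And>y. y \<in> M \<Longrightarrow> inner (x - p) y = 0"
proof -
  define d where "d = infdist x M"
  have ne: "M \<noteq> {}" using assms(2) subspace_0 by blast
  have d0: "0 \<le> d" by (simp add: d_def infdist_nonneg)
  define W where "W n = M \<inter> cball x (d + 1 / real (Suc n))" for n
  have W_ne: "W n \<noteq> {}" for n
  proof -
    have "(INF a\<in>M. dist x a) < d + 1 / real (Suc n)"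
      using ne by (simp add: d_def infdist_notempty)
    then obtain a where "a \<in> M" "dist x a < d + 1 / real (Suc n)"
      using ne by (subst (asm) cINF_less_iff) auto
    then show ?thesis by (auto simp: W_def)
  qed
  have small: "\<exists>n. \<forall>y\<in>W n. \<forall>z\<in>W n. dist y z < e" if "e > 0" for e
  proof -
    have "(\<lambda>n. 4 * (d + 1 / real (Suc n))\<^sup>2 - 4 * d\<^sup>2) \<longlonglongrightarrow> 4 * (d + 0)\<^sup>2 - 4 * d\<^sup>2"
      by (intro tendsto_intros LIMSEQ_inverse_real_of_nat[unfolded inverse_eq_divide])
    then have "\<forall>\<^sub>F n in sequentially. 4 * (d + 1 / real (Suc n))\<^sup>2 - 4 * d\<^sup>2 < e\<^sup>2"
      by (rule order_tendstoD) (use that in simp)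
    then obtain n where n: "4 * (d + 1 / real (Suc n))\<^sup>2 - 4 * d\<^sup>2 < e\<^sup>2"
      using eventually_happens' sequentially_bot by blast
    have "dist y z < e" if y: "y \<in> W n" and z: "z \<in> W n" for y z
    proof -
      have m: "(1/2) *\<^sub>R (y + z) \<in> M"
        using y z assms(2) by (simp add: W_def subspace_add subspace_scale)
      have "d \<le> norm (x - (1/2) *\<^sub>R (y + z))"
        using infdist_le[OF m, of x] by (simp add: d_def dist_norm)
      then have "d\<^sup>2 \<le> (norm (x - (1/2) *\<^sub>R (y + z)))\<^sup>2"
        using d0 by (simp add: power_mono)
      moreover have "(norm (x - y))\<^sup>2 \<le> (d + 1 / real (Suc n))\<^sup>2"
        "(norm (x - z))\<^sup>2 \<le> (d + 1 / real (Suc n))\<^sup>2"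
        using y z by (auto simp: W_def dist_norm intro!: power_mono)
      moreover have "(norm (y - z))\<^sup>2 = 2 * (norm (x - y))\<^sup>2 + 2 * (norm (x - z))\<^sup>2
          - 4 * (norm (x - (1/2) *\<^sub>R (y + z)))\<^sup>2"
        by (simp add: power2_norm_eq_inner inner_simps inner_commute algebra_simps)
      ultimately have "(norm (y - z))\<^sup>2 < e\<^sup>2"
        using n by linarith
      then show ?thesis
        using \<open>e > 0\<close> by (simp add: dist_norm power_less_imp_less_base)
    qed
    then show ?thesis by blast
  qed
  have W_mono: "W n \<subseteq> W m" if "m \<le> n" for m n
    using that by (auto simp: W_def frac_le elim!: order_trans)
  have W_closed: "closed (W n)" for n
    using assms(1) by (simp add: W_def closed_Int)
  obtain p where p: "\<And>n. p \<in> W n"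
    using decreasing_closed_nest[of W, OF W_closed W_ne W_mono small] by blast
  have "p \<in> M" using p[of 0] by (simp add: W_def)
  have "dist x p \<le> d"
  proof (rule LIMSEQ_le_const)
    show "(\<lambda>n. d + 1 / real (Suc n)) \<longlonglongrightarrow> d"
      using tendsto_add[OF tendsto_const LIMSEQ_inverse_real_of_nat, of d]
      by (simp add: inverse_eq_divide)
    show "\<exists>N. \<forall>n\<ge>N. dist x p \<le> d + 1 / real (Suc n)"
      using p by (auto simp: W_def)
  qed
  have "inner (x - p) y = 0" if "y \<in> M" for y
  proof (rule ccontr)
    assume nz: "inner (x - p) y \<noteq> 0"
    then have y: "0 < inner y y" by auto
    \<comment> \<open>The value of \<open>t\<close> that minimizes the distance from \<open>x\<close> to \<open>p + t y\<close>.\<close>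
    define t where "t = inner (x - p) y / inner y y"
    have "p + t *\<^sub>R y \<in> M"
      using \<open>p \<in> M\<close> that assms(2) by (simp add: subspace_add subspace_scale)
    then have "d \<le> norm (x - (p + t *\<^sub>R y))"
      by (metis d_def dist_norm infdist_le)
    then have "norm (x - p) \<le> norm (x - (p + t *\<^sub>R y))"
      using \<open>dist x p \<le> d\<close> by (simp add: dist_norm)
    then have "(norm (x - p))\<^sup>2 \<le> (norm ((x - p) - t *\<^sub>R y))\<^sup>2"
      by (simp add: power_mono algebra_simps)
    also have "\<dots> = (norm (x - p))\<^sup>2 - 2 * t * inner (x - p) y + t\<^sup>2 * inner y y"
      by (simp only: power2_norm_eq_inner inner_diff_left[of _ _ "_ - t *\<^sub>R y"]
          inner_diff_right inner_scaleR_left inner_scaleR_right inner_commute[of y "x - p"])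
        (simp add: power2_eq_square inner_diff_left inner_commute algebra_simps)
    also have "\<dots> = (norm (x - p))\<^sup>2 - (inner (x - p) y)\<^sup>2 / inner y y"
      using y by (simp add: t_def power2_eq_square field_simps)
    finally have "(inner (x - p) y)\<^sup>2 / inner y y \<le> 0" by simp
    then show False
      using y nz by (simp add: divide_le_0_iff)
  qed
  then show thesis using that \<open>p \<in> M\<close> by blast
qed

lemma exists_complex_orthogonal_foot:
  fixes M :: "'a::complex_hilbert set"
  assumes "closed M" "complex_vector.subspace M"
  obtains p where "p \<in> M" "\<And>y. y \<in> M \<Longrightarrow> cinner (x - p) y = 0"
proof -
  obtain p where p: "p \<in> M" "\<And>y. y \<in> M \<Longrightarrow> inner (x - p) y = 0"
    using exists_orthogonal_foot[OF assms(1) csubspace_imp_subspace[OF assms(2)]] by blast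
  have "cinner (x - p) y = 0" if "y \<in> M" for y
  proof (rule complex_eqI)
    show "Re (cinner (x - p) y) = Re 0"
      using p(2)[OF that] by (simp add: inner_cinner)
    \<comment> \<open>The imaginary part is the real inner product with \<open>\<i> y\<close>, again a vector of \<open>M\<close>.\<close>
    have "\<i> *\<^sub>C y \<in> M"
      using assms(2) that by (simp add: complex_vector.subspace_scale)
    then show "Im (cinner (x - p) y) = Im 0"
      using p(2)[of "\<i> *\<^sub>C y"] by (simp add: inner_cinner cinner_scaleC_right)
  qed
  then show thesis using that p(1) by blast
qed

definition orthonormal :: "'a::complex_inner set \<Rightarrow> bool"
  where "orthonormal B \<longleftrightarrow> (\<forall>x\<in>B. \<forall>y\<in>B. cinner x y = (if x = y then 1 else 0))"

lemma orthonormal_basis_iff: "orthonormal_basis M B \<longleftrightarrow> orthonormal B \<and> closed_cspan B = M"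
  by (simp only: orthonormal_basis_def orthonormal_def)

lemma orthonormal_subset: "orthonormal B \<Longrightarrow> C \<subseteq> B \<Longrightarrow> orthonormal C"
  unfolding orthonormal_def by (meson subsetD)

text \<open>A maximal orthonormal subset of \<open>M\<close> spans a dense subspace: otherwise the normalized
  difference between a vector of \<open>M\<close> and its foot on the span could be added to it.\<close>

lemma orthonormal_basis_exists:
  fixes M :: "'a::complex_hilbert set"
  assumes "closed M" "complex_vector.subspace M"
  shows "\<exists>B. orthonormal_basis M B"
proof -
  define \<A> where "\<A> = {B. B \<subseteq> M \<and> orthonormal B}"
  have "\<exists>B\<in>\<A>. \<forall>X\<in>\<A>. B \<subseteq> X \<longrightarrow> X = B"
  proof (rule subset_Zorn')
    fix \<C> assume \<C>: "subset.chain \<A> \<C>"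
    have "cinner x y = (if x = y then 1 else 0)" if xy: "x \<in> \<Union>\<C>" "y \<in> \<Union>\<C>" for x y
    proof -
      obtain X Y where XY: "X \<in> \<C>" "x \<in> X" "Y \<in> \<C>" "y \<in> Y"
        using xy by blast
      then have "X \<subseteq> Y \<or> Y \<subseteq> X"
        using \<C> by (simp add: subset_chain_def)
      then obtain Z where Z: "Z \<in> \<C>" "x \<in> Z" "y \<in> Z"
        using XY by blast
      then have "orthonormal Z"
        using \<C> by (auto simp: subset_chain_def \<A>_def)
      then show ?thesis
        using Z by (simp add: orthonormal_def)
    qed
    then show "\<Union>\<C> \<in> \<A>"
      using \<C> by (auto simp: \<A>_def orthonormal_def subset_chain_def)
  qed
  then obtain B where B: "B \<subseteq> M" "orthonormal B"
    and max: "\<And>X. X \<subseteq> M \<Longrightarrow> orthonormal X \<Longrightarrow> B \<subseteq> X \<Longrightarrow> X = B"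
    by (auto simp: \<A>_def)
  have sub: "closed_cspan B \<subseteq> M"
    using B(1) assms by (intro closed_cspan_minimal)
  moreover have "M \<subseteq> closed_cspan B"
  proof
    fix x assume x: "x \<in> M"
    have "closed (closed_cspan B)" by (simp add: closed_cspan_def)
    then obtain p where p: "p \<in> closed_cspan B"
      "\<And>y. y \<in> closed_cspan B \<Longrightarrow> cinner (x - p) y = 0"
      using exists_complex_orthogonal_foot[OF _ csubspace_closed_cspan] by blast
    show "x \<in> closed_cspan B"
    proof (rule ccontr)
      assume "x \<notin> closed_cspan B"
      then have nz: "x - p \<noteq> 0" using p(1) by auto
      define e where "e = (1 / norm (x - p)) *\<^sub>R (x - p)"
      have e1: "cinner e e = 1"
        using nz by (simp add: e_def cinner_scaleR_left cinner_scaleR_right cinner_self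
            power2_eq_square flip: of_real_mult)
      have e0: "cinner e b = 0" if "b \<in> closed_cspan B" for b
        using p(2)[OF that] by (simp add: e_def cinner_scaleR_left)
      have e0': "cinner b e = 0" if "b \<in> closed_cspan B" for b
        using e0[OF that] by (metis cinner_commute complex_cnj_zero)
      have "x - p \<in> M"
        using x p(1) sub assms(2) complex_vector.subspace_diff by blast
      then have "e \<in> M"
        using assms(2) by (simp add: e_def scaleR_scaleC complex_vector.subspace_scale)
      moreover have "orthonormal (insert e B)"
        using B(2) e0 e0' e1 closed_cspan_superset[of B]
        by (auto simp: orthonormal_def)
      ultimately have "e \<in> B"
        using max[of "insert e B"] B(1) by blast
      then show False
        using e0[of e] e1 closed_cspan_superset[of B] by auto
    qed
  qed
  ultimately show ?thesis
    using B(2) by (auto simp only: orthonormal_basis_iff)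
qed

lemma hilbert_dim_basis:
  fixes M :: "'a::complex_hilbert set"
  assumes "closed M" "complex_vector.subspace M"
  obtains B where "hilbert_dim M = |B|" "orthonormal B" "closed_cspan B = M"
proof -
  have "orthonormal_basis M (SOME B. orthonormal_basis M B)"
    using orthonormal_basis_exists[OF assms] by (rule someI_ex)
  then show thesis
    using that[of "SOME B. orthonormal_basis M B"]
    by (simp only: hilbert_dim_def orthonormal_basis_iff)
qed


section \<open>Adjoints and projections\<close>

lemma bounded_op_linear:
  assumes "bounded_op A"
  shows "A (x + y) = A x + A y" "A (x - y) = A x - A y" "A (c *\<^sub>C x) = c *\<^sub>C A x" "A 0 = 0"
  using assms
  by (simp_all add: bounded_op_def linear_add linear_diff linear_0 bounded_linear.linear)

lemma bounded_op_continuous: "bounded_op A \<Longrightarrow> continuous_on X A"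
  by (simp add: bounded_op_def linear_continuous_on)

lemma bounded_op_comp: "bounded_op A \<Longrightarrow> bounded_op B \<Longrightarrow> bounded_op (A \<circ> B)"
  using bounded_linear_compose[of A B] by (simp add: bounded_op_def o_def)

lemma csubspace_range: "bounded_op A \<Longrightarrow> complex_vector.subspace (range A)"
  unfolding complex_vector.subspace_def
  by (safe; metis bounded_op_linear(1,3,4) rangeI)

text \<open>A nonzero vector \<open>u\<close> orthogonal to the kernel represents \<open>f\<close> up to a scalar, which is fixed
  by evaluation at \<open>u\<close>.\<close>

lemma riesz_representation:
  fixes f :: "'a::complex_hilbert \<Rightarrow> complex"
  assumes "bounded_linear f" "\<And>c x. f (c *\<^sub>C x) = c * f x"
  shows "\<exists>z. \<forall>x. f x = cinner x z"
proof (cases "\<forall>x. f x = 0")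
  case True
  then show ?thesis by (intro exI[of _ 0]) simp
next
  case False
  interpret f: bounded_linear f by fact
  define N where "N = {x. f x = 0}"
  obtain x where x: "f x \<noteq> 0" using False by blast
  have "closed N"
    unfolding N_def by (intro closed_Collect_eq f.continuous_on continuous_intros)
  moreover have "complex_vector.subspace N"
    by (simp add: N_def complex_vector.subspace_def f.add f.zero assms(2))
  ultimately obtain p where p: "p \<in> N" "\<And>y. y \<in> N \<Longrightarrow> cinner (x - p) y = 0"
    using exists_complex_orthogonal_foot by blast
  define u where "u = x - p"
  have fu: "f u \<noteq> 0" using x p(1) by (simp add: u_def f.diff N_def)
  then have u: "cinner u u \<noteq> 0" by (auto simp: f.zero)
  have "f y = cinner y ((cnj (f u) / cnj (cinner u u)) *\<^sub>C u)" for y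
  proof -
    \<comment> \<open>The kernel has codimension one: \<open>y\<close> differs from a multiple of \<open>u\<close> by a vector of it.\<close>
    have "f (y - (f y / f u) *\<^sub>C u) = 0"
      using fu by (simp add: f.diff assms(2))
    then have "cinner u (y - (f y / f u) *\<^sub>C u) = 0"
      using p(2) by (simp add: N_def u_def)
    then have "cinner (y - (f y / f u) *\<^sub>C u) u = 0"
      by (metis cinner_commute complex_cnj_zero)
    then have "cinner y u = (f y / f u) * cinner u u"
      by (simp add: cinner_diff_left cinner_scaleC_left)
    then show ?thesis
      using u fu by (simp add: cinner_scaleC_right)
  qed
  then show ?thesis by blast
qed

lemma adj_eqI:
  assumes "\<And>x y. cinner (A x) y = cinner x (B y)"
  shows "adj A = B"
  unfolding adj_def
proof (rule the_equality)
  fix C assume C: "\<forall>x y. cinner (A x) y = cinner x (C y)"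
  show "C = B"
  proof (rule ext, rule cinner_eqI_right)
    show "cinner z (C y) = cinner z (B y)" for y z
      using C[rule_format, of z y] assms[of z y] by simp
  qed
qed (use assms in blast)

lemma cinner_adj:
  fixes A :: "'a::complex_hilbert \<Rightarrow> 'b::complex_inner"
  assumes "bounded_op A"
  shows "cinner (A x) y = cinner x (adj A y)"
proof -
  have "\<exists>z. \<forall>x. cinner (A x) y = cinner x z" for y
    using assms bounded_linear_compose[OF bounded_linear_cinner_left, of A]
    by (intro riesz_representation) (simp_all add: bounded_op_def cinner_scaleC_left)
  then obtain B where B: "\<And>x y. cinner (A x) y = cinner x (B y)"
    by metis
  show ?thesis
    unfolding adj_eqI[of A B, OF B] by (rule B)
qed

lemma cinner_adj':
  fixes A :: "'a::complex_hilbert \<Rightarrow> 'b::complex_inner"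
  assumes "bounded_op A"
  shows "cinner y (A x) = cinner (adj A y) x"
  by (metis assms cinner_adj cinner_commute)

lemma bounded_op_adj:
  fixes A :: "'a::complex_hilbert \<Rightarrow> 'b::complex_inner"
  assumes "bounded_op A"
  shows "bounded_op (adj A)"
proof -
  have add: "adj A (x + y) = adj A x + adj A y" for x y
    by (rule cinner_eqI_right) (simp add: cinner_add_right flip: cinner_adj[OF assms])
  have scale: "adj A (c *\<^sub>C x) = c *\<^sub>C adj A x" for c x
    by (rule cinner_eqI_right) (simp add: cinner_scaleC_right flip: cinner_adj[OF assms])
  obtain K where K: "K \<ge> 0" "\<And>x. norm (A x) \<le> norm x * K"
    using assms bounded_linear.nonneg_bounded unfolding bounded_op_def by metis
  have "norm (adj A y) \<le> norm y * K" for y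
  proof (cases "adj A y = 0")
    case False
    have "(norm (adj A y))\<^sup>2 = cmod (cinner (A (adj A y)) y)"
      by (simp only: norm_power2_cinner cinner_adj[OF assms])
    also have "\<dots> \<le> norm (A (adj A y)) * norm y"
      by (rule norm_cinner_le)
    also have "\<dots> \<le> (norm (adj A y) * K) * norm y"
      by (intro mult_right_mono K) simp
    finally have "norm (adj A y) * norm (adj A y) \<le> norm (adj A y) * (norm y * K)"
      by (simp add: power2_eq_square mult_ac)
    then show ?thesis
      using False by (simp add: mult_le_cancel_left)
  qed (use K in simp)
  then have "bounded_linear (adj A)"
    by (intro bounded_linear_intro[where K = K]) (simp_all add: add scale scaleR_scaleC)
  then show ?thesis
    by (simp add: bounded_op_def scale)
qed

lemma projection_cinner:
  fixes P :: "'a::complex_hilbert \<Rightarrow> 'a"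
  assumes "projection P"
  shows "cinner (P x) y = cinner x (P y)"
  using assms cinner_adj[of P] by (simp add: projection_def)

lemma projection_idem: "projection P \<Longrightarrow> P (P x) = P x"
  by (metis comp_apply projection_def)

text \<open>Symmetry alone forces linearity, and together with idempotence it forces contractivity.\<close>

lemma projectionI:
  fixes P :: "'a::complex_inner \<Rightarrow> 'a"
  assumes sym: "\<And>x y. cinner (P x) y = cinner x (P y)" and idem: "\<And>x. P (P x) = P x"
  shows "projection P"
proof -
  have add: "P (x + y) = P x + P y" for x y
    by (rule cinner_eqI_left) (simp add: sym cinner_add_left)
  have scale: "P (c *\<^sub>C x) = c *\<^sub>C P x" for c x
    by (rule cinner_eqI_left) (simp add: sym cinner_scaleC_left)
  have "norm (P x) \<le> norm x * 1" for x
  proof (cases "P x = 0")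
    case False
    have "(norm (P x))\<^sup>2 = cmod (cinner (P x) x)"
      by (simp only: norm_power2_cinner sym idem)
    also have "\<dots> \<le> norm (P x) * norm x"
      by (rule norm_cinner_le)
    finally show ?thesis
      using False by (simp add: power2_eq_square mult_le_cancel_left)
  qed simp
  then have "bounded_linear P"
    by (intro bounded_linear_intro[where K = 1]) (simp_all add: add scale scaleR_scaleC)
  moreover have "adj P = P"
    using sym by (rule adj_eqI)
  ultimately show ?thesis
    by (simp add: projection_def bounded_op_def scale idem fun_eq_iff)
qed


section \<open>Rank and Gram operators\<close>

lemma cinner_sum_left: "cinner (\<Sum>i\<in>F. f i) y = (\<Sum>i\<in>F. cinner (f i) y)"
  by (induction F rule: infinite_finite_induct) (simp_all add: cinner_add_left)

lemma cinner_sum_right: "cinner x (\<Sum>i\<in>F. f i) = (\<Sum>i\<in>F. cinner x (f i))"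
  by (induction F rule: infinite_finite_induct) (simp_all add: cinner_add_right)

lemma bessel_inequality:
  assumes "finite F" "orthonormal F"
  shows "(\<Sum>c\<in>F. (cmod (cinner v c))\<^sup>2) \<le> (norm v)\<^sup>2"
proof -
  define s where "s = (\<Sum>c\<in>F. cinner v c *\<^sub>C c)"
  define q where "q = (\<Sum>c\<in>F. (cmod (cinner v c))\<^sup>2)"
  have cs: "cinner c s = cnj (cinner v c)" if "c \<in> F" for c
  proof -
    have "cinner c s = (\<Sum>d\<in>F. if c = d then cnj (cinner v d) else 0)"
      unfolding s_def cinner_sum_right
      by (intro sum.cong refl)
        (use that assms(2) in \<open>simp only: orthonormal_def cinner_scaleC_right, simp\<close>)
    then show ?thesis using that assms(1) by simp
  qed
  have q: "complex_of_real q = (\<Sum>c\<in>F. cinner v c * cnj (cinner v c))"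
    by (simp only: q_def complex_norm_square of_real_sum)
  have ss: "cinner s s = complex_of_real q"
    unfolding q by (subst (1) s_def) (simp add: cinner_sum_left cinner_scaleC_left cs)
  have vs: "cinner v s = complex_of_real q"
    unfolding q s_def by (simp add: cinner_sum_right cinner_scaleC_right mult.commute)
  then have sv: "cinner s v = complex_of_real q"
    by (metis cinner_commute complex_cnj_complex_of_real)
  have "complex_of_real ((norm (v - s))\<^sup>2) = complex_of_real ((norm v)\<^sup>2 - q)"
    unfolding of_real_diff cinner_self[symmetric]
    by (simp only: cinner_diff_left cinner_diff_right ss vs sv) simp
  then have "(norm (v - s))\<^sup>2 = (norm v)\<^sup>2 - q"
    using of_real_eq_iff by blast
  then show ?thesis
    unfolding q_def[symmetric] by (metis diff_ge_0_iff_ge zero_le_power2)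
qed

lemma countable_nonzero_coefficients:
  assumes "orthonormal C"
  shows "countable {c \<in> C. cinner v c \<noteq> 0}"
proof -
  have "(\<lambda>c. (cmod (cinner v c))\<^sup>2) summable_on C"
  proof (rule nonneg_bdd_above_summable_on)
    show "bdd_above (sum (\<lambda>c. (cmod (cinner v c))\<^sup>2) ` {F. F \<subseteq> C \<and> finite F})"
      using bessel_inequality orthonormal_subset[OF assms]
      by (intro bdd_aboveI[of _ "(norm v)\<^sup>2"]) blast
  qed simp
  then have "countable {c \<in> C. (cmod (cinner v c))\<^sup>2 \<noteq> 0}"
    by (rule summable_countable_real)
  then show ?thesis by simp
qed

text \<open>The vectors that equal their finite expansion form a closed subspace containing \<open>B\<close>.\<close>

lemma closed_cspan_finite_orthonormal:
  assumes "finite B" "orthonormal B"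
  shows "closed_cspan B \<subseteq> complex_vector.span B"
proof -
  define N where "N = {x. x = (\<Sum>b\<in>B. cinner x b *\<^sub>C b)}"
  have "continuous_on UNIV (\<lambda>x. \<Sum>b\<in>B. cinner x b *\<^sub>C b)"
  proof (intro continuous_on_sum)
    fix b assume "b \<in> B"
    have "bounded_linear (\<lambda>c. c *\<^sub>C b)"
      by (rule bounded_linear_intro[where K = "norm b"])
        (simp_all add: scaleC_add_left scaleR_scaleC[of _ b] scaleR_scaleC scaleC_scaleC norm_scaleC
          scaleC_complex_def)
    from bounded_linear_compose[OF this bounded_linear_cinner_left[of b]]
    show "continuous_on UNIV (\<lambda>x. cinner x b *\<^sub>C b)"
      by (rule linear_continuous_on)
  qed
  then have "closed N"
    unfolding N_def by (rule closed_Collect_eq[OF continuous_on_id])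
  moreover have "complex_vector.subspace N"
  proof -
    have "(\<Sum>b\<in>B. cinner (c *\<^sub>C x) b *\<^sub>C b) = c *\<^sub>C (\<Sum>b\<in>B. cinner x b *\<^sub>C b)" for c x
      by (simp add: cinner_scaleC_left complex_vector.scale_sum_right scaleC_scaleC)
    then show ?thesis
      by (auto simp: N_def complex_vector.subspace_def cinner_add_left scaleC_add_left sum.distrib)
  qed
  moreover have "B \<subseteq> N"
  proof
    fix x assume x: "x \<in> B"
    have "(\<Sum>b\<in>B. cinner x b *\<^sub>C b) = (\<Sum>b\<in>B. if x = b then b else 0)"
      by (intro sum.cong refl)
        (use x assms(2) in \<open>simp only: orthonormal_def, simp add: scaleC_one\<close>)
    then show "x \<in> N" using x assms(1) by (simp add: N_def)
  qed
  ultimately have "closed_cspan B \<subseteq> N"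
    by (intro closed_cspan_minimal)
  moreover have "N \<subseteq> complex_vector.span B"
  proof
    fix x assume "x \<in> N"
    moreover have "(\<Sum>b\<in>B. cinner x b *\<^sub>C b) \<in> complex_vector.span B"
      by (intro complex_vector.span_sum complex_vector.span_scale complex_vector.span_base)
    ultimately show "x \<in> complex_vector.span B" by (simp add: N_def)
  qed
  ultimately show ?thesis by blast
qed

lemma orthonormal_independent:
  assumes "orthonormal C"
  shows "complex_vector.independent C"
  unfolding complex_vector.independent_explicit_module
proof (intro allI impI)
  fix F u v
  assume F: "finite F" "F \<subseteq> C" and zero: "(\<Sum>w\<in>F. u w *\<^sub>C w) = 0" and v: "v \<in> F"
  have "0 = cinner (\<Sum>w\<in>F. u w *\<^sub>C w) v"
    by (simp add: zero)
  also have "\<dots> = (\<Sum>w\<in>F. u w * cinner w v)"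
    by (simp add: cinner_sum_left cinner_scaleC_left)
  also have "\<dots> = (\<Sum>w\<in>F. if v = w then u w else 0)"
  proof (intro sum.cong refl)
    fix w assume "w \<in> F"
    then have "cinner w v = (if w = v then 1 else 0)"
      using F v assms unfolding orthonormal_def by blast
    then show "u w * cinner w v = (if v = w then u w else 0)" by simp
  qed
  also have "\<dots> = u v" using F v by simp
  finally show "u v = 0" ..
qed

text \<open>For finite \<open>B\<close> this is linear algebra. For infinite \<open>B\<close>, each \<open>A c\<close> is nonzero and so has
  a nonzero coefficient at some \<open>b \<in> B\<close>; that coefficient is the one of \<open>adj A b\<close> at \<open>c\<close>, so by
  Bessel each \<open>b\<close> accounts for countably many \<open>c\<close> only, and \<open>C\<close> is a union of \<open>|B|\<close>
  countable sets.\<close>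

lemma card_orthonormal_le_of_injective:
  fixes A :: "'a::complex_hilbert \<Rightarrow> 'b::complex_inner"
  assumes A: "bounded_op A"
    and C: "orthonormal C"
    and B: "orthonormal B"
    and into: "\<And>x. x \<in> closed_cspan C \<Longrightarrow> A x \<in> closed_cspan B"
    and inj: "\<And>x. x \<in> closed_cspan C \<Longrightarrow> A x = 0 \<Longrightarrow> x = 0"
  shows "|C| \<le>o |B|"
proof (cases "finite B")
  case True
  interpret pair: vector_space_pair "scaleC :: complex \<Rightarrow> 'a \<Rightarrow> 'a" "scaleC :: complex \<Rightarrow> 'b \<Rightarrow> 'b"
    by unfold_locales
  have lin: "Vector_Spaces.linear (scaleC :: complex \<Rightarrow> 'a \<Rightarrow> 'a) (scaleC :: complex \<Rightarrow> 'b \<Rightarrow> 'b) A"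
    using A by unfold_locales (simp_all add: bounded_op_linear)
  have span: "complex_vector.span C \<subseteq> closed_cspan C"
    by (simp add: closed_cspan_def closure_subset)
  have injA: "inj_on A (complex_vector.span C)"
  proof (rule inj_onI)
    fix x y assume xy: "x \<in> complex_vector.span C" "y \<in> complex_vector.span C" "A x = A y"
    then have "x - y \<in> closed_cspan C"
      using span complex_vector.span_diff by blast
    moreover have "A (x - y) = 0" using xy(3) A by (simp add: bounded_op_linear)
    ultimately show "x = y" using inj by fastforce
  qed
  have "complex_vector.independent (A ` C)"
    using pair.linear_independent_injective_image[OF lin orthonormal_independent[OF C] injA] .
  moreover have "A ` C \<subseteq> complex_vector.span B"
    using into closed_cspan_superset[of C] closed_cspan_finite_orthonormal[OF True B] by blast
  ultimately have "finite (A ` C) \<and> card (A ` C) \<le> card B"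
    by (rule complex_vector.independent_span_bound[OF True])
  moreover have "inj_on A C"
    using injA complex_vector.span_superset by (rule inj_on_subset)
  ultimately have "finite C" "card C \<le> card B"
    by (simp_all add: finite_image_iff card_image)
  then obtain f where "inj_on f C" "f ` C \<subseteq> B"
    using True card_le_inj by metis
  then show ?thesis
    using card_of_ordLeqI[of f C B] by blast
next
  case False
  have "C \<subseteq> (\<Union>b\<in>B. {c \<in> C. cinner (adj A b) c \<noteq> 0})"
  proof
    fix c assume c: "c \<in> C"
    then have cC: "c \<in> closed_cspan C" using closed_cspan_superset by blast
    have "cinner c c \<noteq> 0" using C c unfolding orthonormal_def by auto
    then have "A c \<noteq> 0" using inj[OF cC] by auto
    then obtain b where "b \<in> B" "cinner b (A c) \<noteq> 0"
      using cinner_closed_cspan_zero[of B "A c" "A c"] into[OF cC] cinner_self_eq_zero by blast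
    then show "c \<in> (\<Union>b\<in>B. {c \<in> C. cinner (adj A b) c \<noteq> 0})"
      using c by (auto simp: cinner_adj'[OF A])
  qed
  then have "C = (\<Union>b\<in>B. {c \<in> C. cinner (adj A b) c \<noteq> 0})"
    by blast
  moreover have "|\<Union>b\<in>B. {c \<in> C. cinner (adj A b) c \<noteq> 0}| \<le>o |B|"
  proof (rule card_of_UNION_ordLeq_infinite[OF False])
    show "|B| \<le>o |B|" by (rule card_of_mono1) simp
    show "\<forall>b\<in>B. |{c \<in> C. cinner (adj A b) c \<noteq> 0}| \<le>o |B|"
      using countable_nonzero_coefficients[OF C] False
      by (meson countable_card_of_nat infinite_iff_card_of_nat ordLeq_transitive)
  qed
  ultimately show ?thesis by simp
qed

text \<open>The operators \<open>A\<close> and \<open>adj A\<close> map the closures of the ranges of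
  \<open>adj A \<circ> A\<close> and of \<open>A\<close> injectively into each other, because a vector of the closure of a range
  that is orthogonal to that range vanishes.\<close>

lemma op_rank_adj_comp:
  fixes A :: "'a::complex_hilbert \<Rightarrow> 'b::complex_hilbert"
  assumes A: "bounded_op A"
  shows "op_rank A =o op_rank (adj A \<circ> A)"
proof -
  note A' = bounded_op_adj[OF A]
  let ?M = "closure (range (adj A \<circ> A))" and ?N = "closure (range A)"
  obtain B where B: "hilbert_dim ?M = |B|" "orthonormal B" "closed_cspan B = ?M"
    using hilbert_dim_basis[OF _ csubspace_closure[OF csubspace_range[OF bounded_op_comp[OF A' A]]]]
    by auto
  obtain C where C: "hilbert_dim ?N = |C|" "orthonormal C" "closed_cspan C = ?N"
    using hilbert_dim_basis[OF _ csubspace_closure[OF csubspace_range[OF A]]] by auto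
  have "|B| \<le>o |C|"
  proof (rule card_orthonormal_le_of_injective[OF A B(2) C(2)])
    show "A x \<in> closed_cspan C" for x
      unfolding C(3) using closure_subset[of "range A"] by blast
    show "x = 0" if "x \<in> closed_cspan B" "A x = 0" for x
    proof -
      have "cinner y x = 0" if "y \<in> range (adj A \<circ> A)" for y
        using that \<open>A x = 0\<close> by (auto simp flip: cinner_adj'[OF A])
      then have "cinner x x = 0"
        using \<open>x \<in> closed_cspan B\<close> unfolding B(3) by (rule cinner_closure_zero)
      then show ?thesis by simp
    qed
  qed
  moreover have "|C| \<le>o |B|"
  proof (rule card_orthonormal_le_of_injective[OF A' C(2) B(2)])
    have "adj A ` ?N \<subseteq> closure (adj A ` range A)"
      using A' by (intro closure_bounded_linear_image_subset) (simp add: bounded_op_def)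
    then show "adj A x \<in> closed_cspan B" if "x \<in> closed_cspan C" for x
      using that unfolding B(3) C(3) image_comp by blast
    show "x = 0" if "x \<in> closed_cspan C" "adj A x = 0" for x
    proof -
      have "cinner y x = 0" if "y \<in> range A" for y
        using that \<open>adj A x = 0\<close> by (auto simp: cinner_adj[OF A])
      then have "cinner x x = 0"
        using \<open>x \<in> closed_cspan C\<close> unfolding C(3) by (rule cinner_closure_zero)
      then show ?thesis by simp
    qed
  qed
  ultimately show ?thesis
    unfolding op_rank_def B(1) C(1) by (simp add: ordIso_iff_ordLeq)
qed


section \<open>Defect operators\<close>

lemma row_contraction_has_sum:
  assumes "row_contraction I T"
  shows "((\<lambda>i. T i (adj (T i) x)) has_sum sot_sum (\<lambda>i. T i \<circ> adj (T i)) I x) I"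
  using assms by (simp add: row_contraction_def sot_summable_def sot_sum_def has_sum_infsum)

text \<open>Written with the adjoints alone, the form of the row sum is visibly Hermitian, and its values
  on a subspace invariant under the adjoints depend only on their restrictions.\<close>

lemma cinner_row_has_sum:
  fixes T :: "'i \<Rightarrow> 'a::complex_hilbert \<Rightarrow> 'a"
  assumes "row_contraction I T" "nonzero_ops I T"
  shows "((\<lambda>i. cinner (adj (T i) x) (adj (T i) y)) has_sum
    cinner (sot_sum (\<lambda>i. T i \<circ> adj (T i)) I x) y) I"
proof -
  have "((\<lambda>i. cinner (T i (adj (T i) x)) y) has_sum
      cinner (sot_sum (\<lambda>i. T i \<circ> adj (T i)) I x) y) I"
    by (rule has_sum_bounded_linear[OF bounded_linear_cinner_left row_contraction_has_sum])
      (rule assms(1))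
  moreover have "cinner (T i (adj (T i) x)) y = cinner (adj (T i) x) (adj (T i) y)" if "i \<in> I" for i
    using assms(2) that by (intro cinner_adj) (simp add: nonzero_ops_def)
  ultimately show ?thesis
    by (simp cong: has_sum_cong)
qed

lemma cinner_row_sum_symmetric:
  fixes T :: "'i \<Rightarrow> 'a::complex_hilbert \<Rightarrow> 'a"
  assumes "row_contraction I T" "nonzero_ops I T"
  defines "R \<equiv> sot_sum (\<lambda>i. T i \<circ> adj (T i)) I"
  shows "cinner (R x) y = cinner x (R y)"
proof -
  have "((\<lambda>i. cnj (cinner (adj (T i) y) (adj (T i) x))) has_sum cnj (cinner (R y) x)) I"
    unfolding R_def using cinner_row_has_sum[OF assms(1,2)]
    by (rule has_sum_bounded_linear[OF bounded_linear_cnj])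
  then have "((\<lambda>i. cinner (adj (T i) x) (adj (T i) y)) has_sum cinner x (R y)) I"
    by (simp flip: cinner_commute)
  then show ?thesis
    unfolding R_def using cinner_row_has_sum[OF assms(1,2)] has_sum_unique by blast
qed


section \<open>Tuples satisfying the dagger relations\<close>

text \<open>The vector \<open>adj A (A x) - x\<close> lies in the kernel of \<open>adj A \<circ> A\<close>, which is the kernel of \<open>A\<close>.\<close>

lemma partial_isometryI:
  fixes A :: "'a::complex_hilbert \<Rightarrow> 'b::complex_inner"
  assumes A: "bounded_op A" and idem: "(adj A \<circ> A) \<circ> (adj A \<circ> A) = adj A \<circ> A"
  shows "A (adj A (A x)) = A x"
proof -
  define u where "u = adj A (A x) - x"
  have "adj A (A u) = 0"
    using fun_cong[OF idem, of x]
    by (simp add: u_def bounded_op_linear[OF A] bounded_op_linear[OF bounded_op_adj[OF A]])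
  then have "cinner (A u) (A u) = 0"
    by (simp add: cinner_adj[OF A])
  then show ?thesis
    by (simp add: u_def bounded_op_linear[OF A])
qed

locale dagger_tuple =
  fixes I :: "'i set" and S :: "'i \<Rightarrow> 'k::complex_hilbert \<Rightarrow> 'k"
  assumes dagger: "dagger_relations I S"
begin

abbreviation row_sum :: "'k \<Rightarrow> 'k"
  where "row_sum \<equiv> sot_sum (\<lambda>i. S i \<circ> adj (S i)) I"

lemma ops: "nonzero_ops I S" and contraction: "row_contraction I S"
  using dagger by (simp_all add: dagger_relations_def)

lemma op: "i \<in> I \<Longrightarrow> bounded_op (S i)"
  using ops by (simp add: nonzero_ops_def)

lemma isometric: "i \<in> I \<Longrightarrow> S i (adj (S i) (S i x)) = S i x"
  using dagger op by (intro partial_isometryI) (simp_all add: dagger_relations_def)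

lemma row_sum_symmetric: "cinner (row_sum x) y = cinner x (row_sum y)"
  by (rule cinner_row_sum_symmetric[OF contraction ops])

text \<open>A vector \<open>v\<close> of the range of \<open>S i\<close> is already exhausted by the \<open>i\<close>-th summand of
  \<open>\<Sum>\<^sub>j \<parallel>adj (S j) v\<parallel>\<^sup>2 \<le> \<parallel>v\<parallel>\<^sup>2\<close>, so that the other summands vanish: the ranges are orthogonal.\<close>

lemma row_sum_range:
  assumes i: "i \<in> I"
  shows "row_sum (S i x) = S i x"
proof -
  define v where "v = S i x"
  have v: "S i (adj (S i) v) = v"
    using isometric[OF i] by (simp add: v_def)
  have vv: "(norm (adj (S i) v))\<^sup>2 = (norm v)\<^sup>2"
    by (simp add: norm_power2_cinner v flip: cinner_adj[OF op[OF i]])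
  have "((\<lambda>j. Re (cinner (adj (S j) v) (adj (S j) v))) has_sum Re (cinner (row_sum v) v)) I"
    by (rule has_sum_bounded_linear[OF bounded_linear_Re cinner_row_has_sum[OF contraction ops]])
  then have hs: "((\<lambda>j. (norm (adj (S j) v))\<^sup>2) has_sum Re (cinner (row_sum v) v)) I"
    by (simp add: cinner_self)
  have "cinner (v - row_sum v) v \<in> \<real>\<^sub>\<ge>\<^sub>0"
    using contraction by (simp add: row_contraction_def op_le_def)
  then have le: "Re (cinner (row_sum v) v) \<le> (norm v)\<^sup>2"
    by (simp add: complex_nonneg_Reals_iff cinner_diff_left cinner_self)
  have zero: "adj (S j) v = 0" if j: "j \<in> I" "j \<noteq> i" for j
  proof -
    have "(\<Sum>l\<in>{i, j}. (norm (adj (S l) v))\<^sup>2) \<le> Re (cinner (row_sum v) v)"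
      using hs i j by (intro finite_sum_le_has_sum) auto
    then have "(norm (adj (S i) v))\<^sup>2 + (norm (adj (S j) v))\<^sup>2 \<le> Re (cinner (row_sum v) v)"
      using j by simp
    then have "(norm (adj (S j) v))\<^sup>2 \<le> 0"
      using le vv by linarith
    then show ?thesis by simp
  qed
  have "((\<lambda>j. S j (adj (S j) v)) has_sum v) I"
    using i zero v by (intro has_sum_finite_neutralI[where B = "{i}"])
      (auto simp: bounded_op_linear[OF op])
  then have "row_sum v = v"
    using row_contraction_has_sum[OF contraction] has_sum_unique by blast
  then show ?thesis by (simp add: v_def)
qed

text \<open>The boundedness of the row sum comes only as a consequence of this lemma, so symmetry and not
  continuity moves it past the infinite sum.\<close>

lemma row_sum_idem: "row_sum (row_sum x) = row_sum x"
proof (rule cinner_eqI_left)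
  fix z
  have "((\<lambda>i. cinner (S i (adj (S i) x)) (row_sum z)) has_sum cinner (row_sum x) (row_sum z)) I"
    by (rule has_sum_bounded_linear[OF bounded_linear_cinner_left row_contraction_has_sum])
      (rule contraction)
  moreover have "((\<lambda>i. cinner (S i (adj (S i) x)) z) has_sum cinner (row_sum x) z) I"
    by (rule has_sum_bounded_linear[OF bounded_linear_cinner_left row_contraction_has_sum])
      (rule contraction)
  moreover have "cinner (S i (adj (S i) x)) (row_sum z) = cinner (S i (adj (S i) x)) z"
    if "i \<in> I" for i
    by (simp add: row_sum_range[OF that] flip: row_sum_symmetric)
  ultimately have "cinner (row_sum x) (row_sum z) = cinner (row_sum x) z"
    using has_sum_unique by (simp cong: has_sum_cong) blast
  then show "cinner (row_sum (row_sum x)) z = cinner (row_sum x) z"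
    by (simp add: row_sum_symmetric[of "row_sum x"])
qed

lemma projection_defect: "projection (defect I S)"
proof (rule projectionI)
  show "cinner (defect I S x) y = cinner x (defect I S y)" for x y
    by (simp add: defect_def cinner_diff_left cinner_diff_right row_sum_symmetric)
  have "row_sum (x - row_sum x) = 0" for x
    by (rule cinner_eqI_left)
      (simp add: row_sum_symmetric cinner_diff_left row_sum_idem)
  then show "defect I S (defect I S x) = defect I S x" for x
    by (simp add: defect_def)
qed

lemma defect_range: "i \<in> I \<Longrightarrow> defect I S (S i x) = 0"
  by (simp add: defect_def row_sum_range)

lemma projection_initial: "q \<in> initial_projections I S \<Longrightarrow> projection q"
  by (auto simp: initial_projections_def isometric cinner_adj[OF op] simp flip: cinner_adj'[OF op]
      intro!: projectionI)

text \<open>The range of \<open>S i\<close> lies in that of some initial projection \<open>p\<close>, and \<open>q\<close> is either \<open>p\<close> or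
  orthogonal to it.\<close>

lemma initial_comp_op:
  assumes q: "q \<in> initial_projections I S" and i: "i \<in> I"
  shows "(\<forall>x. q (S i x) = S i x) \<or> (\<forall>x. q (S i x) = 0)"
proof -
  obtain j where j: "j \<in> I" and le: "op_le (S i \<circ> adj (S i)) (adj (S j) \<circ> S j)"
    using dagger i unfolding dagger_relations_def by blast
  define p where "p = adj (S j) \<circ> S j"
  have "p \<in> initial_projections I S" using j by (simp add: p_def initial_projections_def)
  then have p: "projection p" by (rule projection_initial)
  have ker: "adj (S i) x = 0" if "p x = 0" for x
  proof -
    have "0 \<le> Re (cinner (p x - S i (adj (S i) x)) x)"
      using le by (simp add: op_le_def p_def complex_nonneg_Reals_iff)
    also have "\<dots> = - (norm (adj (S i) x))\<^sup>2"
      by (simp only: that cinner_diff_left cinner_adj[OF op[OF i]] cinner_self) simp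
    finally show ?thesis by simp
  qed
  have pS: "p (S i x) = S i x" for x
  proof (rule cinner_eqI_right)
    fix z
    have "p (z - p z) = 0"
      using p by (simp add: bounded_op_linear projection_def projection_idem[OF p])
    then have "cinner (z - p z) (S i x) = 0"
      by (simp add: cinner_adj'[OF op[OF i]] ker)
    then show "cinner z (p (S i x)) = cinner z (S i x)"
      by (simp add: cinner_diff_left flip: projection_cinner[OF p])
  qed
  obtain l where l: "l \<in> I" "q = adj (S l) \<circ> S l"
    using q by (auto simp: initial_projections_def)
  have "q \<circ> p = (\<lambda>_. 0) \<or> q = p"
    using dagger l j unfolding dagger_relations_def p_def by blast
  then show ?thesis
    using pS by (metis comp_apply)
qed

lemma initial_commutes_defect:
  assumes q: "q \<in> initial_projections I S"
  shows "q (defect I S x) = defect I S (q x)"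
proof -
  note Q = projection_initial[OF q]
  have qbl: "bounded_linear q" using Q by (simp add: projection_def bounded_op_def)
  have summand: "q (S i (adj (S i) x)) = S i (adj (S i) (q x))" if i: "i \<in> I" for i
    using initial_comp_op[OF q i]
  proof
    assume qS: "\<forall>x. q (S i x) = S i x"
    have "adj (S i) (q x) = adj (S i) x"
      by (rule cinner_eqI_right)
        (simp add: qS flip: cinner_adj[OF op[OF i]] projection_cinner[OF Q])
    then show ?thesis by (simp add: qS)
  next
    assume qS: "\<forall>x. q (S i x) = 0"
    have "adj (S i) (q x) = 0"
      by (rule cinner_eqI_right)
        (simp add: qS flip: cinner_adj[OF op[OF i]] projection_cinner[OF Q])
    then show ?thesis by (simp add: qS bounded_op_linear[OF op[OF i]])
  qed
  have "((\<lambda>i. q (S i (adj (S i) x))) has_sum q (row_sum x)) I"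
    by (rule has_sum_bounded_linear[OF qbl row_contraction_has_sum[OF contraction]])
  then have "((\<lambda>i. S i (adj (S i) (q x))) has_sum q (row_sum x)) I"
    by (simp add: summand cong: has_sum_cong)
  then have "q (row_sum x) = row_sum (q x)"
    using row_contraction_has_sum[OF contraction] has_sum_unique by blast
  then show ?thesis
    using Q by (simp add: defect_def bounded_op_linear projection_def)
qed

lemma projection_initial_defect:
  assumes q: "q \<in> initial_projections I S"
  shows "projection (q \<circ> defect I S)"
proof (rule projectionI)
  show "cinner ((q \<circ> defect I S) x) y = cinner x ((q \<circ> defect I S) y)" for x y
    by (simp add: initial_commutes_defect[OF q, of y] projection_cinner[OF projection_initial[OF q]]
        projection_cinner[OF projection_defect])
  show "(q \<circ> defect I S) ((q \<circ> defect I S) x) = (q \<circ> defect I S) x" for x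
    by (simp add: projection_idem[OF projection_initial[OF q]] projection_idem[OF projection_defect]
        flip: initial_commutes_defect[OF q])
qed

lemma defect_word:
  assumes "w \<noteq> []" "set w \<subseteq> I"
  shows "defect I S (word_op S w x) = 0"
  using assms by (cases w) (simp_all add: word_op_def defect_range)

end


section \<open>Compression of the defect to the dilated space\<close>

text \<open>The space is spanned by \<open>range \<iota>\<close> and by vectors that the defect operator kills.\<close>

lemma closure_range_initial_defect:
  fixes S :: "'i \<Rightarrow> 'k::complex_hilbert \<Rightarrow> 'k"
  assumes dil: "min_pi_dilation \<iota> I T S" and q: "q \<in> initial_projections I S"
  shows "closure (range (q \<circ> defect I S)) = closure (range (q \<circ> defect I S \<circ> \<iota>))"
proof -
  interpret dagger_tuple I S
    using dil by unfold_locales (simp add: min_pi_dilation_def)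
  let ?E = "q \<circ> defect I S"
  let ?A = "?E \<circ> \<iota>"
  have E: "bounded_op ?E"
    using projection_initial_defect[OF q] by (simp add: projection_def)
  have "bounded_op \<iota>"
    using dil by (simp add: min_pi_dilation_def isometric_embedding_def)
  then have sub: "complex_vector.subspace (closure (range ?A))"
    using bounded_op_comp[OF E] by (intro csubspace_closure csubspace_range)
  have q0: "q 0 = 0"
    using projection_initial[OF q] by (simp add: projection_def bounded_op_linear)
  define X where "X = ?E -` closure (range ?A)"
  have "closed X"
    unfolding X_def using bounded_op_continuous[OF E, of UNIV]
    by (simp add: closed_vimage)
  moreover have "complex_vector.subspace X"
    using sub unfolding complex_vector.subspace_def X_def
    by (simp only: vimage_eq bounded_op_linear[OF E]) blast
  moreover have "range \<iota> \<union> (\<Union>w\<in>{w. w \<noteq> [] \<and> set w \<subseteq> I}. word_op S w ` range \<iota>) \<subseteq> X"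
  proof -
    have "range \<iota> \<subseteq> X"
      using closure_subset[of "range ?A"] by (auto simp: X_def)
    moreover have "word_op S w y \<in> X" if "w \<noteq> []" "set w \<subseteq> I" for w y
      using complex_vector.subspace_0[OF sub] by (simp add: X_def defect_word[OF that] q0)
    ultimately show ?thesis by auto
  qed
  ultimately have "closed_cspan (range \<iota> \<union> (\<Union>w\<in>{w. w \<noteq> [] \<and> set w \<subseteq> I}. word_op S w ` range \<iota>)) \<subseteq> X"
    by (intro closed_cspan_minimal)
  then have "X = UNIV"
    using dil by (auto simp: min_pi_dilation_def)
  then have "range ?E \<subseteq> closure (range ?A)"
    by (auto simp: X_def)
  then have "closure (range ?E) \<subseteq> closure (range ?A)"
    by (simp add: closure_minimal)
  moreover have "closure (range ?A) \<subseteq> closure (range ?E)"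
    by (intro closure_mono) auto
  ultimately show ?thesis by blast
qed

lemma restr_apply:
  assumes "isometric_embedding \<iota>" "A ` range \<iota> \<subseteq> range \<iota>"
  shows "A (\<iota> x) = \<iota> (restr \<iota> A x)"
proof -
  obtain y where "A (\<iota> x) = \<iota> y" using assms(2) by blast
  then show ?thesis
    by (simp add: restr_def f_inv_into_f)
qed

text \<open>Both sides equal \<open>cinner x y - (\<Sum>i. cinner (adj (T i) x) (adj (T i) y))\<close>, since \<open>\<iota>\<close>
  intertwines \<open>adj (T i)\<close> with \<open>adj (S i)\<close>.\<close>

lemma cinner_defect_dilation:
  fixes S :: "'i \<Rightarrow> 'k::complex_hilbert \<Rightarrow> 'k" and T :: "'i \<Rightarrow> 'h::complex_hilbert \<Rightarrow> 'h"
  assumes dil: "min_pi_dilation \<iota> I T S" and T: "nonzero_ops I T" "row_contraction I T"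
  shows "cinner (defect I S (\<iota> x)) (\<iota> y) = cinner (defect I T x) y"
proof -
  interpret dagger_tuple I S
    using dil by unfold_locales (simp add: min_pi_dilation_def)
  have iso: "isometric_embedding \<iota>"
    using dil by (simp add: min_pi_dilation_def)
  then have \<iota>: "cinner (\<iota> u) (\<iota> v) = cinner u v" for u v
    by (simp add: isometric_embedding_def)
  have "adj (S i) (\<iota> u) = \<iota> (adj (T i) u)" if "i \<in> I" for i u
    using dil that restr_apply[OF iso, of "adj (S i)" u] by (simp add: min_pi_dilation_def)
  then have "((\<lambda>i. cinner (adj (T i) x) (adj (T i) y)) has_sum cinner (row_sum (\<iota> x)) (\<iota> y)) I"
    using cinner_row_has_sum[OF contraction ops, of "\<iota> x" "\<iota> y"]
    by (simp add: \<iota> cong: has_sum_cong)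
  then have "cinner (row_sum (\<iota> x)) (\<iota> y) = cinner (sot_sum (\<lambda>i. T i \<circ> adj (T i)) I x) y"
    using cinner_row_has_sum[OF T(2,1)] has_sum_unique by blast
  then show ?thesis
    by (simp add: defect_def cinner_diff_left \<iota>)
qed

text \<open>With \<open>E = q \<circ> defect I S\<close>, a projection, the operator on the right is the compression
  \<open>adj \<iota> \<circ> E \<circ> \<iota>\<close>, which is the Gram operator of \<open>E \<circ> \<iota>\<close>.\<close>

lemma op_rank_initial_defect:
  fixes S :: "'i \<Rightarrow> 'k::complex_hilbert \<Rightarrow> 'k" and T :: "'i \<Rightarrow> 'h::complex_hilbert \<Rightarrow> 'h"
  assumes dil: "min_pi_dilation \<iota> I T S" and T: "nonzero_ops I T" "row_contraction I T"
    and q: "q \<in> initial_projections I S" and restr: "projection (restr \<iota> q)"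
  shows "op_rank (q \<circ> defect I S) =o op_rank (restr \<iota> q \<circ> defect I T)"
proof -
  interpret dagger_tuple I S
    using dil by unfold_locales (simp add: min_pi_dilation_def)
  let ?E = "q \<circ> defect I S"
  let ?A = "?E \<circ> \<iota>"
  have iso: "isometric_embedding \<iota>"
    using dil by (simp add: min_pi_dilation_def)
  note E = projection_initial_defect[OF q] and Q = projection_initial[OF q]
  have A: "bounded_op ?A"
    using bounded_op_comp[of ?E \<iota>] E iso by (simp only: projection_def isometric_embedding_def)
  have "q ` range \<iota> \<subseteq> range \<iota>"
    using dil q unfolding min_pi_dilation_def reduces_def initial_projections_def by blast
  then have q\<iota>: "q (\<iota> y) = \<iota> (restr \<iota> q y)" for y
    by (rule restr_apply[OF iso])
  have "cinner x (adj ?A (?A y)) = cinner x (restr \<iota> q (defect I T y))" for x y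
  proof -
    have "cinner x (adj ?A (?A y)) = cinner (?E (\<iota> x)) (?E (\<iota> y))"
      using cinner_adj[OF A, of x "?A y"] by simp
    also have "\<dots> = cinner (\<iota> x) (?E (\<iota> y))"
      using projection_cinner[OF E] projection_idem[OF E] by metis
    also have "\<dots> = cinner (\<iota> (restr \<iota> q x)) (defect I S (\<iota> y))"
      by (simp add: q\<iota> flip: projection_cinner[OF Q])
    also have "\<dots> = cinner (restr \<iota> q x) (defect I T y)"
      using cinner_defect_dilation[OF dil T, of y "restr \<iota> q x"] cinner_commute by metis
    also have "\<dots> = cinner x (restr \<iota> q (defect I T y))"
      by (rule projection_cinner[OF restr])
    finally show ?thesis .
  qed
  then have "adj ?A \<circ> ?A = restr \<iota> q \<circ> defect I T"
    by (intro ext) (auto intro: cinner_eqI_right)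
  moreover have "op_rank ?E = op_rank ?A"
    by (simp only: op_rank_def closure_range_initial_defect[OF dil q])
  ultimately show ?thesis
    using op_rank_adj_comp[OF A] by simp
qed


section \<open>Rank of the defect at a vertex\<close>

theorem proposition3p6:
  fixes n :: enat
    and T :: "nat \<Rightarrow> 'h::complex_hilbert \<Rightarrow> 'h"
    and J :: "'v set"
    and P :: "'v \<Rightarrow> 'h \<Rightarrow> 'h"
    and G :: "('v, nat) pre_digraph"
    and \<iota> :: "'h \<Rightarrow> 'k::complex_hilbert"
    and S :: "nat \<Rightarrow> 'k \<Rightarrow> 'k"
    and Q :: "'v \<Rightarrow> 'k \<Rightarrow> 'k"
  assumes "n \<noteq> 0"
    and "nonzero_ops {i. enat i < n} T"
    and "row_contraction {i. enat i < n} T"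
    and "stabilizes J P {i. enat i < n} T"
    and "\<forall>k\<in>J. \<exists>i. enat i < n \<and> T i \<circ> P k \<noteq> (\<lambda>_. 0)"
    and "G = assoc_graph J P {i. enat i < n} T"
    and "min_pi_dilation_wrt \<iota> (arcs G) T S (P ` verts G)"
    and "bij_betw Q (verts G) (initial_projections (arcs G) S)"
    and "\<forall>k\<in>verts G. restr \<iota> (Q k) = P k"
  shows "\<forall>k\<in>verts G. op_rank (Q k \<circ> defect (arcs G) S) =o op_rank (P k \<circ> defect (arcs G) T)"
proof
  fix k assume k: "k \<in> verts G"
  have G: "arcs G = {i. enat i < n}" "verts G = J"
    using assms(6) by (simp_all add: assoc_graph_def)
  have dil: "min_pi_dilation \<iota> (arcs G) T S"
    using assms(7) by (simp add: min_pi_dilation_wrt_def)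
  have restr: "restr \<iota> (Q k) = P k"
    using assms(9) k by blast
  have q: "Q k \<in> initial_projections (arcs G) S"
    using assms(8) k by (rule bij_betw_apply)
  have "projection (P k)"
    using assms(4) k by (simp add: G stabilizes_def)
  from op_rank_initial_defect[OF dil assms(2,3)[folded G(1)] q this[folded restr]]
  show "op_rank (Q k \<circ> defect (arcs G) S) =o op_rank (P k \<circ> defect (arcs G) T)"
    unfolding restr .
qed

end
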